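(* Let $n, m \geq 1$ be integers, let $\Bbbk$ be a field with $\operatorname{char}(\Bbbk) = 0$ or $\operatorname{char}(\Bbbk) > n$, and let $G \leq S_n$ be a permutation group acting naturally on $V = \Bbbk^n$ (by permuting the standard basis). Let $V^m = V \oplus \cdots \oplus V$ ($m$ copies) with the diagonal action of $G$. Then $$\beta(G, V^m) \leq \binom{n}{2} + 1.$$
   Context: For a finite group $G$ acting linearly on a finite dimensional $\Bbbk$-vector space $W$, $\Bbbk[W]$ denotes the symmetric algebra on $W^*$ (a polynomial ring with its standard grading), on which $G$ acts by $(gf)(v) = f(g^{-1}v)$ for $g \in G$, $f \in \Bbbk[W]$, $v \in W$. $\Bbbk[W]^G$ is the graded subalgebra of $G$-invariant polynomials. $\beta(G, W)$ denotes the maximal degree of a polynomial in a minimal homogeneous generating set of the $\Bbbk$-algebra $\Bbbk[W]^G$; equivalently, the smallest $d$ such that $\Bbbk[W]^G$ is generated as a $\Bbbk$-algebra by homogeneous invariants of degree at most $d$. *)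

theory Defs
  imports
    "HOL-Algebra.Sym_Groups"
    "HOL-Computational_Algebra.Computational_Algebra"
    "HOL-Library.Poly_Mapping"
    "HOL-Library.Extended_Nat"
begin

text \<open>
  A polynomial over \<open>'k\<close> in variables from \<open>'x\<close> is a finitely supported map from monomials
  (finitely supported exponent vectors) to coefficients; its ring structure is the convolution
  product of \<^theory>\<open>HOL-Library.Poly_Mapping\<close>.
\<close>

type_synonym ('x, 'k) mpoly = "('x \<Rightarrow>\<^sub>0 nat) \<Rightarrow>\<^sub>0 'k"

definition Const :: "'k::zero \<Rightarrow> ('x, 'k) mpoly" where
  "Const c = Poly_Mapping.single 0 c"

definition Var :: "'x \<Rightarrow> ('x, 'k::zero_neq_one) mpoly" where
  "Var x = Poly_Mapping.single (Poly_Mapping.single x 1) 1"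

definition mon_degree :: "('x \<Rightarrow>\<^sub>0 nat) \<Rightarrow> nat" where
  "mon_degree t = (\<Sum>x\<in>Poly_Mapping.keys t. Poly_Mapping.lookup t x)"

definition homogeneous :: "nat \<Rightarrow> ('x, 'k::zero) mpoly \<Rightarrow> bool" where
  "homogeneous d f \<longleftrightarrow> (\<forall>t\<in>Poly_Mapping.keys f. mon_degree t = d)"

text \<open>
  For a finite set \<open>X\<close>, the vector space \<open>W = 'k\<^sup>X\<close> consists of the functions \<open>'x \<Rightarrow> 'k\<close> vanishing
  outside \<open>X\<close>. The coordinate functions \<open>Var x\<close>, \<open>x \<in> X\<close>, form a basis of the dual space of \<open>W\<close>,
  so the symmetric algebra \<open>'k[W]\<close> on that dual is the polynomial ring in these variables.
\<close>

definition coord_ring :: "'x set \<Rightarrow> ('x, 'k::zero) mpoly set" where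
  "coord_ring X = {f. \<forall>t\<in>Poly_Mapping.keys f. Poly_Mapping.keys t \<subseteq> X}"

definition unit_vec :: "'x \<Rightarrow> 'x \<Rightarrow> 'k::zero_neq_one" where
  "unit_vec y = (\<lambda>z. if z = y then 1 else 0)"

text \<open>
  For a linear map \<open>A\<close> on \<open>W\<close>, \<open>pullback X A f\<close> is the polynomial \<open>f \<circ> A\<close>. As a polynomial is not
  determined by its values when \<open>'k\<close> is finite, this is defined on the symmetric algebra: the
  coordinate function \<open>Var x\<close> goes to the linear form \<open>v \<mapsto> (A v) x\<close>, and this is extended to an
  algebra homomorphism. Lemma \<open>eval_at_pullback\<close> below relates it to values.
\<close>

definition linear_form :: "'x set \<Rightarrow> (('x \<Rightarrow> 'k) \<Rightarrow> 'x \<Rightarrow> 'k) \<Rightarrow> 'x \<Rightarrow> ('x, 'k::field) mpoly" where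
  "linear_form X A x = (\<Sum>y\<in>X. Const (A (unit_vec y) x) * Var y)"

definition pullback ::
    "'x set \<Rightarrow> (('x \<Rightarrow> 'k) \<Rightarrow> 'x \<Rightarrow> 'k) \<Rightarrow> ('x, 'k::field) mpoly \<Rightarrow> ('x, 'k) mpoly" where
  "pullback X A f =
     (\<Sum>t\<in>Poly_Mapping.keys f. Const (Poly_Mapping.lookup f t) *
        (\<Prod>x\<in>Poly_Mapping.keys t. linear_form X A x ^ Poly_Mapping.lookup t x))"

text \<open>
  In the following \<open>\<rho> g\<close> is the linear map by which \<open>g\<close> acts on \<open>W = 'k\<^sup>X\<close>.
\<close>

definition poly_action ::
    "('g, 'b) monoid_scheme \<Rightarrow> 'x set \<Rightarrow> ('g \<Rightarrow> ('x \<Rightarrow> 'k) \<Rightarrow> 'x \<Rightarrow> 'k) \<Rightarrow>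
     'g \<Rightarrow> ('x, 'k::field) mpoly \<Rightarrow> ('x, 'k) mpoly" where
  "poly_action G X \<rho> g f = pullback X (\<rho> (inv\<^bsub>G\<^esub> g)) f"

definition invariants ::
    "('g, 'b) monoid_scheme \<Rightarrow> 'x set \<Rightarrow> ('g \<Rightarrow> ('x \<Rightarrow> 'k) \<Rightarrow> 'x \<Rightarrow> 'k) \<Rightarrow>
     ('x, 'k::field) mpoly set" where
  "invariants G X \<rho> = {f \<in> coord_ring X. \<forall>g\<in>carrier G. poly_action G X \<rho> g f = f}"

inductive_set generated_algebra :: "('x, 'k::field) mpoly set \<Rightarrow> ('x, 'k) mpoly set"
  for S :: "('x, 'k) mpoly set" where
  const: "Const c \<in> generated_algebra S"
| gen: "f \<in> S \<Longrightarrow> f \<in> generated_algebra S"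
| add: "f \<in> generated_algebra S \<Longrightarrow> h \<in> generated_algebra S \<Longrightarrow> f + h \<in> generated_algebra S"
| mult: "f \<in> generated_algebra S \<Longrightarrow> h \<in> generated_algebra S \<Longrightarrow> f * h \<in> generated_algebra S"

text \<open>
  The value is taken in the extended naturals so that it is \<open>\<infinity>\<close>, rather than an arbitrary number,
  should no degree bound exist.
\<close>

definition beta ::
    "('g, 'b) monoid_scheme \<Rightarrow> 'x set \<Rightarrow> ('g \<Rightarrow> ('x \<Rightarrow> 'k::field) \<Rightarrow> 'x \<Rightarrow> 'k) \<Rightarrow> enat" where
  "beta G X \<rho> = Inf {enat d |d.
     invariants G X \<rho> =
       generated_algebra {f \<in> invariants G X \<rho>. \<exists>e\<le>d. homogeneous e f}}"

text \<open>
  \<open>g\<close> sends the basis vector \<open>e\<^sub>i\<close> to \<open>e\<^bsub>g i\<^esub>\<close>, that is, \<open>(g v)\<^sub>i = v\<^bsub>g\<^sup>-\<^sup>1 i\<^esub>\<close>.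
\<close>

definition perm_rep :: "('x \<Rightarrow> 'x) \<Rightarrow> ('x \<Rightarrow> 'k) \<Rightarrow> 'x \<Rightarrow> 'k" where
  "perm_rep g v = (\<lambda>i. v (inv_into UNIV g i))"

text \<open>
  If \<open>V = 'k\<^sup>X\<close>, then the direct sum of \<open>m\<close> copies of \<open>V\<close> is \<open>'k\<^sup>X\<^sup>\<times>\<^sup>J\<close> with \<open>J = {1..m}\<close>, the \<open>j\<close>-th
  component of \<open>v\<close> being \<open>\<lambda>i. v (i, j)\<close>.
\<close>

definition diag_rep ::
    "('g \<Rightarrow> ('x \<Rightarrow> 'k) \<Rightarrow> 'x \<Rightarrow> 'k) \<Rightarrow> 'g \<Rightarrow> ('x \<times> nat \<Rightarrow> 'k) \<Rightarrow> 'x \<times> nat \<Rightarrow> 'k" where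
  "diag_rep \<rho> g v = (\<lambda>(i, j). \<rho> g (\<lambda>i'. v (i', j)) i)"

lemma perm_rep_unit_vec: "bij g \<Longrightarrow> perm_rep g (unit_vec i) = unit_vec (g i)"
  by (auto simp: perm_rep_def unit_vec_def fun_eq_iff bij_is_inj bij_is_surj surj_f_inv_f)

lemma poly_action_perm_Var:
  fixes G :: "(nat \<Rightarrow> nat) set"
  assumes "subgroup G (sym_group n)" and "g \<in> G" and "i \<in> {1..n}" and "j \<in> {1..m}"
  shows "poly_action ((sym_group n)\<lparr>carrier := G\<rparr>) ({1..n} \<times> {1..m}) (diag_rep perm_rep) g
           (Var (i, j) :: (nat \<times> nat, 'k::field) mpoly) = Var (g i, j)"
proof -
  have g: "g \<in> carrier (sym_group n)"
    using assms subgroup.subset by blast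
  then have perm: "g permutes {1..n}"
    by (simp add: sym_group_carrier)
  have inv: "inv\<^bsub>(sym_group n)\<lparr>carrier := G\<rparr>\<^esub> g = inv_into UNIV g"
    using group.m_inv_consistent[OF sym_group_is_group assms(1,2)] g by simp
  have *: "diag_rep perm_rep (inv_into UNIV g) (unit_vec y) (i, j) =
      (if y = (g i, j) then 1 else 0 :: 'k)" for y
    using perm by (auto simp: diag_rep_def perm_rep_def unit_vec_def permutes_bij inv_inv_eq)
  have "linear_form ({1..n} \<times> {1..m}) (diag_rep perm_rep (inv_into UNIV g)) (i, j) =
      (\<Sum>y\<in>{1..n} \<times> {1..m}. if y = (g i, j) then Var y else 0 :: (nat \<times> nat, 'k) mpoly)"
    unfolding linear_form_def * by (intro sum.cong) (auto simp: Const_def)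
  also have "\<dots> = Var (g i, j)"
    using assms(3,4) permutes_in_image[OF perm, of i] by (simp add: sum.delta)
  finally show ?thesis
    by (simp add: poly_action_def pullback_def inv Var_def Const_def)
qed

definition eval_at :: "('x \<Rightarrow> 'k) \<Rightarrow> ('x, 'k::field) mpoly \<Rightarrow> 'k" where
  "eval_at v f = (\<Sum>t\<in>Poly_Mapping.keys f. Poly_Mapping.lookup f t *
     (\<Prod>x\<in>Poly_Mapping.keys t. v x ^ Poly_Mapping.lookup t x))"

lemma mpoly_induct [case_names single add]:
  assumes single: "\<And>t c. P (Poly_Mapping.single t c)" and add: "\<And>f h. P f \<Longrightarrow> P h \<Longrightarrow> P (f + h)"
  shows "P (f :: ('x, 'k::field) mpoly)"
proof (induction f rule: update_induct)
  case const
  show ?case using single[of 0 0] by simp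
next
  case (update f t c)
  have "Poly_Mapping.update t c f = f + Poly_Mapping.single t c"
    using update(1)
    by (intro poly_mapping_eqI) (auto simp: lookup_update lookup_add lookup_single in_keys_iff when_def)
  then show ?case using add[OF update(3) single] by simp
qed

context
  fixes v :: "'x \<Rightarrow> 'k::field"
begin

private definition mon :: "('x \<Rightarrow>\<^sub>0 nat) \<Rightarrow> 'k" where
  "mon t = (\<Prod>x\<in>Poly_Mapping.keys t. v x ^ Poly_Mapping.lookup t x)"

private lemma mon_superset:
  "finite S \<Longrightarrow> Poly_Mapping.keys t \<subseteq> S \<Longrightarrow> mon t = (\<Prod>x\<in>S. v x ^ Poly_Mapping.lookup t x)"
  unfolding mon_def by (rule prod.mono_neutral_left) (auto simp: in_keys_iff)

private lemma mon_add: "mon (s + t) = mon s * mon t"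
proof -
  let ?S = "Poly_Mapping.keys s \<union> Poly_Mapping.keys t"
  have "mon (s + t) = (\<Prod>x\<in>?S. v x ^ Poly_Mapping.lookup (s + t) x)"
    by (rule mon_superset) (use keys_add[of s t] in auto)
  also have "\<dots> = (\<Prod>x\<in>?S. v x ^ Poly_Mapping.lookup s x) * (\<Prod>x\<in>?S. v x ^ Poly_Mapping.lookup t x)"
    by (simp add: lookup_add power_add prod.distrib)
  finally show ?thesis
    by (simp add: mon_superset[of ?S s] mon_superset[of ?S t])
qed

private lemma eval_at_superset:
  "finite S \<Longrightarrow> Poly_Mapping.keys f \<subseteq> S \<Longrightarrow> eval_at v f = (\<Sum>t\<in>S. Poly_Mapping.lookup f t * mon t)"
  unfolding eval_at_def mon_def by (rule sum.mono_neutral_left) (auto simp: in_keys_iff)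

lemma eval_at_add: "eval_at v (f + h) = eval_at v f + eval_at v h"
proof -
  let ?S = "Poly_Mapping.keys f \<union> Poly_Mapping.keys h"
  have "eval_at v (f + h) = (\<Sum>t\<in>?S. Poly_Mapping.lookup (f + h) t * mon t)"
    by (rule eval_at_superset) (use keys_add[of f h] in auto)
  then show ?thesis
    by (simp add: lookup_add distrib_right sum.distrib
        eval_at_superset[of ?S f] eval_at_superset[of ?S h])
qed

private lemma eval_at_single: "eval_at v (Poly_Mapping.single t c) = c * mon t"
  by (simp add: eval_at_superset[of "{t}"])

lemma eval_at_sum: "eval_at v (sum F I) = (\<Sum>i\<in>I. eval_at v (F i))"
proof (induction I rule: infinite_finite_induct)
  case (insert i I)
  then show ?case by (simp add: eval_at_add)
qed (simp_all add: eval_at_def)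

lemma eval_at_mult: "eval_at v (f * h) = eval_at v f * eval_at v h"
proof (induction f rule: mpoly_induct)
  case (single t c)
  show ?case
  proof (induction h rule: mpoly_induct)
    case (single s d)
    show ?case by (simp add: mult_single eval_at_single mon_add)
  qed (simp add: distrib_left eval_at_add)
qed (simp add: distrib_right eval_at_add)

lemma eval_at_Const: "eval_at v (Const c) = c"
  by (simp add: Const_def eval_at_single mon_def)

lemma eval_at_Var: "eval_at v (Var x) = v x"
  by (simp add: Var_def eval_at_single mon_def)

lemma eval_at_power: "eval_at v (f ^ k) = eval_at v f ^ k"
  by (induction k) (simp_all add: eval_at_mult eval_at_Const[of 1, unfolded Const_def single_one])

lemma eval_at_prod: "eval_at v (prod F I) = (\<Prod>i\<in>I. eval_at v (F i))"
  by (induction I rule: infinite_finite_induct)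
     (simp_all add: eval_at_mult eval_at_Const[of 1, unfolded Const_def single_one])

lemma eval_at_pullback:
  assumes "\<And>x. A v x = (\<Sum>y\<in>X. v y * A (unit_vec y) x)"
  shows "eval_at v (pullback X A f) = eval_at (A v) f"
proof -
  have "eval_at v (linear_form X A x) = A v x" for x
    by (simp add: linear_form_def eval_at_sum eval_at_mult eval_at_Const eval_at_Var assms mult.commute)
  then show ?thesis
    by (simp add: pullback_def eval_at_sum eval_at_mult eval_at_Const eval_at_prod eval_at_power eval_at_def[of "A v"])
qed

end

end

theory Submission
  imports Defs
begin

text \<open>
  Let \<open>R\<close> be the polynomial ring in the variables \<open>x\<^sub>i\<^sub>j\<close>, where \<open>i\<close> is one of \<open>n\<close> positions and \<open>j\<close>
  one of \<open>m\<close> colours; permutations act on positions. The proof bounds the degrees in which the ideal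
  generated by invariants of the full symmetric group can differ from \<open>R\<close>, and descends to \<open>G\<close> by
  averaging.

  For one colour, the complete symmetric polynomial \<open>h\<^sub>k\<close> in the first \<open>n - k + 1\<close> variables lies in the
  ideal generated by the symmetric polynomials without constant term. With its leading monomial
  \<open>x\<^sub>q\<^sup>k\<close>, \<open>q = n - k + 1\<close>, it reduces every monomial to those whose exponent at each position \<open>q\<close> is
  at most \<open>n - q\<close>, and these have degree at most \<open>n choose 2\<close>. The argument survives
  polarization: the polarized \<open>h\<^sub>k\<close> of arbitrary factors \<open>1, \<dots>, k\<close> has as its leading term the product
  of these factors at position \<open>q\<close>, with coefficient \<open>k!\<close>, and all its other terms move some factors
  to smaller positions while each factor keeps its colour. As \<open>k!\<close> is invertible for \<open>k \<le> n\<close>, every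
  monomial of degree greater than \<open>n choose 2\<close> lies in the ideal generated by invariants of the
  symmetric group of degrees \<open>1, \<dots>, n\<close> (lemma \<open>monomial_mem\<close>, and \<open>forms_subset_symmetric_ideal\<close> for
  \<open>R\<close>).

  Since the order of \<open>G\<close> divides \<open>n!\<close>, each \<open>G\<close>-invariant is an average over \<open>G\<close>. Averaging a
  combination of invariants of the symmetric group replaces the coefficients by \<open>G\<close>-invariants of
  smaller degree, so that by induction on the degree the invariants are generated in degrees at most
  the maximum of \<open>n\<close> and \<open>n choose 2\<close> (lemmas \<open>transfer_mem_generated_algebra\<close> and
  \<open>invariants_generated\<close>). This is at most \<open>(n choose 2) + 1\<close>.
\<close>

section \<open>Polarized complete symmetric polynomials\<close>

definition fibre_weight :: "'i set \<Rightarrow> 'l set \<Rightarrow> ('l \<Rightarrow> 'i) \<Rightarrow> nat" where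
  "fibre_weight P J f = (\<Prod>i\<in>P. fact (card {l\<in>J. f l = i}))"

text \<open>
  The full polarization of the complete homogeneous symmetric polynomial \<open>h\<^sub>k\<close> in variables indexed by
  \<open>P\<close>, where \<open>k = card J\<close>. If \<open>y i l = x\<^sub>i\<close> for all \<open>l\<close>, it becomes \<open>k! h\<^sub>k\<close>: a monomial of degree \<open>k\<close> with exponents \<open>a\<^sub>i\<close> comes from \<open>k! / (\<Prod>i. a\<^sub>i!)\<close> maps \<open>f\<close>, each of weight
  \<open>\<Prod>i. a\<^sub>i!\<close>, and so gets the coefficient \<open>k!\<close>. In general each index \<open>l\<close> carries its own
  family of variables \<open>y i l\<close>, and \<open>y i l\<close> is the variable of family \<open>l\<close> at position \<open>i\<close>.
\<close>

definition polarized_h :: "('i \<Rightarrow> 'l \<Rightarrow> 'a::comm_semiring_1) \<Rightarrow> 'i set \<Rightarrow> 'l set \<Rightarrow> 'a" where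
  "polarized_h y P J =
     (\<Sum>f\<in>J \<rightarrow>\<^sub>E P. of_nat (fibre_weight P J f) * (\<Prod>l\<in>J. y (f l) l))"

lemma fibre_weight_remove:
  assumes "finite P" "q \<notin> P" "finite J" "l \<in> J" "f l = q"
  shows "fibre_weight (insert q P) J f
    = card {l'\<in>J. f l' = q} * fibre_weight (insert q P) (J - {l}) f"
proof -
  have "{l'\<in>J. f l' = q} = insert l {l' \<in> J - {l}. f l' = q}"
    using assms by auto
  then have "fact (card {l'\<in>J. f l' = q})
      = card {l'\<in>J. f l' = q} * (fact (card {l'\<in>J - {l}. f l' = q}) :: nat)"
    using assms by simp
  moreover have "{l' \<in> J - {l}. f l' = i} = {l'\<in>J. f l' = i}" if "i \<in> P" for i
    using assms that by auto
  ultimately show ?thesis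
    using assms by (simp add: fibre_weight_def)
qed

lemma sum_PiE_fixed_value:
  fixes F :: "('l \<Rightarrow> 'i) \<Rightarrow> 'a::comm_monoid_add"
  assumes "l \<in> J" "q \<in> P"
  shows "(\<Sum>f\<in>{f \<in> J \<rightarrow>\<^sub>E P. f l = q}. F f) = (\<Sum>f\<in>(J - {l}) \<rightarrow>\<^sub>E P. F (f(l := q)))"
proof (rule sum.reindex_bij_witness[of _ "\<lambda>f. f(l := q)" "\<lambda>f. f(l := undefined)"])
  fix f assume "f \<in> {f \<in> J \<rightarrow>\<^sub>E P. f l = q}"
  then show "f(l := undefined) \<in> J - {l} \<rightarrow>\<^sub>E P" "f(l := undefined, l := q) = f"
    by (auto simp: PiE_iff extensional_def)
  then show "F ((f(l := undefined))(l := q)) = F f" by simp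
next
  fix f assume f: "f \<in> J - {l} \<rightarrow>\<^sub>E P"
  then show "f(l := q, l := undefined) = f"
    by (auto simp: PiE_iff extensional_def)
  show "f(l := q) \<in> {f \<in> J \<rightarrow>\<^sub>E P. f l = q}"
    using f assms by (auto simp: PiE_iff extensional_def)
qed

text \<open>
  Polarized form of \<open>h\<^sub>k(P, q) = h\<^sub>k(P) + x\<^sub>q h\<^sub>k\<^sub>-\<^sub>1(P, q)\<close>. A map \<open>f\<close> that takes the value \<open>q\<close> on
  \<open>c > 0\<close> indices arises from \<open>c\<close> terms of the last sum, one for each index that is removed, and each
  of these has the weight of \<open>f\<close> divided by \<open>c\<close>.
\<close>

lemma polarized_h_insert:
  fixes y :: "'i \<Rightarrow> 'l \<Rightarrow> 'a::comm_semiring_1"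
  assumes "finite P" "q \<notin> P" "finite J"
  shows "polarized_h y (insert q P) J
    = polarized_h y P J + (\<Sum>l\<in>J. y q l * polarized_h y (insert q P) (J - {l}))"
proof -
  let ?Q = "insert q P"
  let ?F = "J \<rightarrow>\<^sub>E ?Q"
  let ?m = "\<lambda>f. \<Prod>l\<in>J. y (f l) l"
  let ?c = "\<lambda>f. card {l\<in>J. f l = q}"
  let ?v = "\<lambda>l f. of_nat (fibre_weight ?Q (J - {l}) f) * ?m f"
  have fin: "finite ?F"
    using assms by (simp add: finite_PiE)
  have avoid: "{f\<in>?F. ?c f = 0} = J \<rightarrow>\<^sub>E P"
    using assms(2,3) by (auto simp: PiE_def Pi_iff)
  have zero: "(\<Sum>f\<in>{f\<in>?F. ?c f = 0}. of_nat (fibre_weight ?Q J f) * ?m f) = polarized_h y P J"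
    unfolding polarized_h_def
  proof (rule sum.cong[OF avoid])
    fix f assume "f \<in> J \<rightarrow>\<^sub>E P"
    then have "{l\<in>J. f l = q} = {}"
      using assms(2) by (auto simp: PiE_iff)
    then show "of_nat (fibre_weight ?Q J f) * ?m f = of_nat (fibre_weight P J f) * ?m f"
      using assms(1,2) by (simp add: fibre_weight_def del: Collect_empty_eq)
  qed
  have "(\<Sum>f\<in>{f\<in>?F. ?c f \<noteq> 0}. of_nat (fibre_weight ?Q J f) * ?m f)
      = (\<Sum>f\<in>{f\<in>?F. ?c f \<noteq> 0}. \<Sum>l\<in>{l\<in>J. f l = q}. ?v l f)"
  proof (intro sum.cong refl)
    fix f assume "f \<in> {f\<in>?F. ?c f \<noteq> 0}"
    then obtain l0 where l0: "l0 \<in> J" "f l0 = q"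
      by (auto simp: card_eq_0_iff)
    \<comment> \<open>all summands over the fibre of \<open>q\<close> are equal, and there are as many as the factor lost\<close>
    have "?v l f = ?v l0 f" if "l \<in> {l\<in>J. f l = q}" for l
      using fibre_weight_remove[OF assms, of l f] fibre_weight_remove[OF assms, of l0 f] l0 that
        \<open>f \<in> {f\<in>?F. ?c f \<noteq> 0}\<close> by simp
    then have "(\<Sum>l\<in>{l\<in>J. f l = q}. ?v l f) = of_nat (?c f) * ?v l0 f"
      by simp
    then show "of_nat (fibre_weight ?Q J f) * ?m f = (\<Sum>l\<in>{l\<in>J. f l = q}. ?v l f)"
      by (simp add: fibre_weight_remove[OF assms, of l0 f] l0 mult.assoc)
  qed
  also have "\<dots> = (\<Sum>f\<in>?F. \<Sum>l\<in>{l\<in>J. f l = q}. ?v l f)"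
    by (intro sum.mono_neutral_left ballI sum.neutral) (use fin assms(3) in auto)
  also have "\<dots> = (\<Sum>l\<in>J. \<Sum>f\<in>{f\<in>?F. f l = q}. ?v l f)"
    by (rule sum.swap_restrict[OF fin assms(3)])
  also have "\<dots> = (\<Sum>l\<in>J. y q l * polarized_h y ?Q (J - {l}))"
  proof (rule sum.cong[OF refl])
    fix l assume l: "l \<in> J"
    have "(\<Sum>f\<in>{f\<in>?F. f l = q}. ?v l f) = (\<Sum>f\<in>(J - {l}) \<rightarrow>\<^sub>E ?Q. ?v l (f(l := q)))"
      by (rule sum_PiE_fixed_value) (use l in auto)
    also have "\<dots> = (\<Sum>f\<in>(J - {l}) \<rightarrow>\<^sub>E ?Q. y q l *
        (of_nat (fibre_weight ?Q (J - {l}) f) * (\<Prod>l'\<in>J - {l}. y (f l') l')))"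
    proof (rule sum.cong[OF refl])
      fix f :: "'l \<Rightarrow> 'i"
      have "fibre_weight ?Q (J - {l}) (f(l := q)) = fibre_weight ?Q (J - {l}) f"
        unfolding fibre_weight_def by (intro prod.cong refl arg_cong[of _ _ "\<lambda>S. fact (card S)"]) auto
      moreover have "?m (f(l := q)) = y q l * (\<Prod>l'\<in>J - {l}. y (f l') l')"
        by (subst prod.remove[OF assms(3) l]) (auto intro!: prod.cong arg_cong2[of _ _ _ _ "(*)"])
      ultimately show "?v l (f(l := q)) = y q l *
          (of_nat (fibre_weight ?Q (J - {l}) f) * (\<Prod>l'\<in>J - {l}. y (f l') l'))"
        by (simp add: ac_simps)
    qed
    finally show "(\<Sum>f\<in>{f\<in>?F. f l = q}. ?v l f) = y q l * polarized_h y ?Q (J - {l})"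
      by (simp add: polarized_h_def sum_distrib_left)
  qed
  finally have nonzero: "(\<Sum>f\<in>{f\<in>?F. ?c f \<noteq> 0}. of_nat (fibre_weight ?Q J f) * ?m f)
      = (\<Sum>l\<in>J. y q l * polarized_h y ?Q (J - {l}))" .
  have "?F = {f\<in>?F. ?c f = 0} \<union> {f\<in>?F. ?c f \<noteq> 0}"
    by auto
  then have "polarized_h y ?Q J
      = (\<Sum>f\<in>{f\<in>?F. ?c f = 0} \<union> {f\<in>?F. ?c f \<noteq> 0}. of_nat (fibre_weight ?Q J f) * ?m f)"
    by (simp add: polarized_h_def)
  also have "\<dots> = polarized_h y P J + (\<Sum>l\<in>J. y q l * polarized_h y ?Q (J - {l}))"
    unfolding zero[symmetric] nonzero[symmetric] using fin by (intro sum.union_disjoint) auto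
  finally show ?thesis .
qed

lemma polarized_h_permute:
  fixes y :: "'i \<Rightarrow> 'l \<Rightarrow> 'a::comm_semiring_1"
  assumes "g permutes P" "finite P"
  shows "polarized_h (\<lambda>i. y (g i)) P J = polarized_h y P J"
  unfolding polarized_h_def
proof (rule sum.reindex_bij_witness[of _ "\<lambda>f. restrict (inv_into UNIV g \<circ> f) J" "\<lambda>f. restrict (g \<circ> f) J"])
  fix f assume f: "f \<in> J \<rightarrow>\<^sub>E P"
  show "restrict (inv_into UNIV g \<circ> restrict (g \<circ> f) J) J = f"
    using f permutes_inverses[OF assms(1)]
    by (auto simp: fun_eq_iff PiE_iff extensional_def restrict_def)
  show "restrict (g \<circ> f) J \<in> J \<rightarrow>\<^sub>E P"
    using f permutes_in_image[OF assms(1)] by (auto simp: PiE_iff)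
  have "fibre_weight P J f = (\<Prod>i\<in>P. fact (card {l\<in>J. f l = inv_into UNIV g i}))"
    unfolding fibre_weight_def
    by (rule prod.permute[OF permutes_inv[OF assms(1)], unfolded comp_def])
  also have "\<dots> = fibre_weight P J (restrict (g \<circ> f) J)"
    unfolding fibre_weight_def using permutes_inverses[OF assms(1)]
    by (intro prod.cong refl arg_cong[of _ _ "\<lambda>S. fact (card S)"]) (auto simp: fun_eq_iff)
  finally show "of_nat (fibre_weight P J (restrict (g \<circ> f) J)) * (\<Prod>l\<in>J. y (restrict (g \<circ> f) J l) l)
      = of_nat (fibre_weight P J f) * (\<Prod>l\<in>J. y (g (f l)) l)"
    by simp
next
  fix f assume f: "f \<in> J \<rightarrow>\<^sub>E P"
  show "restrict (g \<circ> restrict (inv_into UNIV g \<circ> f) J) J = f"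
    using f permutes_inverses[OF assms(1)]
    by (auto simp: fun_eq_iff PiE_iff extensional_def restrict_def)
  show "restrict (inv_into UNIV g \<circ> f) J \<in> J \<rightarrow>\<^sub>E P"
    using f permutes_in_image[OF permutes_inv[OF assms(1)]] by (auto simp: PiE_iff)
qed

text \<open>
  The summand that puts all of \<open>J\<close> at position \<open>q\<close>; its coefficient \<open>(card J)!\<close> is where the
  assumption on the characteristic enters.
\<close>

lemma polarized_h_leading:
  fixes y :: "'i \<Rightarrow> 'l \<Rightarrow> 'a::comm_semiring_1"
  assumes "finite P" "q \<in> P" "finite J"
  shows "polarized_h y P J = of_nat (fact (card J)) * (\<Prod>l\<in>J. y q l)
    + (\<Sum>f\<in>(J \<rightarrow>\<^sub>E P) - {\<lambda>l\<in>J. q}. of_nat (fibre_weight P J f) * (\<Prod>l\<in>J. y (f l) l))"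
proof -
  have "fibre_weight P J (\<lambda>l\<in>J. q) = (\<Prod>i\<in>P. if i = q then fact (card J) else 1)"
    unfolding fibre_weight_def
    by (intro prod.cong refl) (auto intro!: arg_cong[of _ _ card])
  then have "fibre_weight P J (\<lambda>l\<in>J. q) = fact (card J)"
    using assms by (simp add: prod.delta)
  then show ?thesis
    unfolding polarized_h_def using assms
    by (subst sum.remove[of _ "\<lambda>l\<in>J. q"]) (auto simp: finite_PiE)
qed

section \<open>Reduction of monomials modulo symmetric polynomials\<close>

text \<open>
  A graded ideal, given by its homogeneous parts \<open>I d\<close>, which contains the polarized complete
  symmetric polynomials in all \<open>n\<close> positions in degrees \<open>1, \<dots>, n\<close> and in which factorials up to
  \<open>n!\<close> can be cancelled.
\<close>

locale graded_ideal_with_symmetric =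
  fixes y :: "nat \<Rightarrow> 'l \<Rightarrow> 'a::comm_ring_1" and n :: nat and I :: "nat \<Rightarrow> 'a set"
  assumes zero: "0 \<in> I d"
    and add: "a \<in> I d \<Longrightarrow> b \<in> I d \<Longrightarrow> a + b \<in> I d"
    and uminus: "a \<in> I d \<Longrightarrow> - a \<in> I d"
    and mult: "i \<in> {1..n} \<Longrightarrow> a \<in> I d \<Longrightarrow> y i l * a \<in> I (Suc d)"
    and cancel_fact: "k \<le> n \<Longrightarrow> of_nat (fact k) * a \<in> I d \<Longrightarrow> a \<in> I d"
    and symmetric: "finite J \<Longrightarrow> J \<noteq> {} \<Longrightarrow> card J \<le> n \<Longrightarrow> polarized_h y {1..n} J \<in> I (card J)"
begin

lemma diff: "a \<in> I d \<Longrightarrow> b \<in> I d \<Longrightarrow> a - b \<in> I d"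
  using add[of a d "- b"] uminus[of b d] by simp

lemma sum: "(\<And>x. x \<in> A \<Longrightarrow> F x \<in> I d) \<Longrightarrow> sum F A \<in> I d"
  by (induction A rule: infinite_finite_induct) (auto intro: zero add)

lemma of_nat_mult: "a \<in> I d \<Longrightarrow> of_nat c * a \<in> I d"
  by (induction c) (auto intro: zero add simp: distrib_right)

lemma prod_mult:
  assumes "finite K" "\<And>l. l \<in> K \<Longrightarrow> p l \<in> {1..n}" "a \<in> I d"
  shows "(\<Prod>l\<in>K. y (p l) l) * a \<in> I (d + card K)"
  using assms
proof (induction K rule: finite_induct)
  case (insert l K)
  then have "y (p l) l * ((\<Prod>l\<in>K. y (p l) l) * a) \<in> I (Suc (d + card K))"
    by (intro mult) auto
  then show ?case
    using insert.hyps by (simp add: mult.assoc)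
qed auto

text \<open>
  Modulo the ideal, \<open>h\<^sub>k\<close> of all \<open>n\<close> positions vanishes for \<open>k \<ge> 1\<close>. Each position that is left out
  costs one degree, since \<open>h\<^sub>k(1..q) = h\<^sub>k(1..q+1) - x\<^sub>q\<^sub>+\<^sub>1 h\<^sub>k\<^sub>-\<^sub>1(1..q+1)\<close>.
\<close>

lemma polarized_h_initial_segment:
  assumes "q \<le> n" "finite J" "n - q < card J" "card J \<le> n"
  shows "polarized_h y {1..q} J \<in> I (card J)"
  using assms
proof (induction "n - q" arbitrary: q J)
  case 0
  then show ?case
    using symmetric[of J] by (cases "J = {}") auto
next
  case (Suc r)
  then have q: "{1..Suc q} = insert (Suc q) {1..q}" "r = n - Suc q" "Suc q \<le> n"
    by auto
  have "polarized_h y {1..Suc q} J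
      = polarized_h y {1..q} J + (\<Sum>l\<in>J. y (Suc q) l * polarized_h y {1..Suc q} (J - {l}))"
    unfolding q(1) using Suc.prems by (intro polarized_h_insert) auto
  then have "polarized_h y {1..q} J
      = polarized_h y {1..Suc q} J - (\<Sum>l\<in>J. y (Suc q) l * polarized_h y {1..Suc q} (J - {l}))"
    by simp
  also have "\<dots> \<in> I (card J)"
  proof (intro diff sum)
    show "polarized_h y {1..Suc q} J \<in> I (card J)"
      using Suc.prems q by (intro Suc.hyps) auto
  next
    fix l assume l: "l \<in> J"
    have card: "card J = Suc (card (J - {l}))"
      using l Suc.prems by (metis card.remove)
    have "polarized_h y {1..Suc q} (J - {l}) \<in> I (card (J - {l}))"
      using Suc.prems q card by (intro Suc.hyps) auto
    then have "y (Suc q) l * polarized_h y {1..Suc q} (J - {l}) \<in> I (Suc (card (J - {l})))"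
      using q by (intro mult) auto
    then show "y (Suc q) l * polarized_h y {1..Suc q} (J - {l}) \<in> I (card J)"
      using card by simp
  qed
  finally show ?case .
qed

text \<open>
  Pigeonhole principle: the capacities \<open>n - q\<close> of the positions \<open>q\<close> add up to \<open>n choose 2\<close>.
\<close>

lemma ex_crowded_position:
  assumes "finite L" "p \<in> L \<rightarrow> {1..n}" "card L > n choose 2"
  obtains q J where "q \<in> {1..n}" "J \<subseteq> {l\<in>L. p l = q}" "card J = Suc (n - q)"
proof -
  have "\<exists>q\<in>{1..n}. n - q < card {l\<in>L. p l = q}"
  proof (rule ccontr)
    assume "\<not> ?thesis"
    then have *: "card {l\<in>L. p l = q} \<le> n - q" if "q \<in> {1..n}" for q
      using that by (auto simp: not_less)
    have "L = (\<Union>q\<in>{1..n}. {l\<in>L. p l = q})"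
      using assms(2) by auto
    then have "card L \<le> (\<Sum>q\<in>{1..n}. card {l\<in>L. p l = q})"
      using card_UN_le[of "{1..n}" "\<lambda>q. {l\<in>L. p l = q}"] by simp
    also have "\<dots> \<le> (\<Sum>q=1..n. n - q)"
      using * by (rule sum_mono)
    also have "\<dots> = (\<Sum>r<n. r)"
      by (rule sum.reindex_bij_witness[of _ "\<lambda>r. n - r" "\<lambda>q. n - q"]) auto
    also have "\<dots> = n choose 2"
      by (induction n) (auto simp: numeral_2_eq_2)
    finally show False
      using assms(3) by simp
  qed
  then obtain q where "q \<in> {1..n}" "Suc (n - q) \<le> card {l\<in>L. p l = q}"
    by auto
  then show thesis
    using that obtain_subset_with_card_n by metis
qed

text \<open>
  If position \<open>q\<close> carries at least \<open>n - q + 1\<close> factors, then \<open>polarized_h y {1..q} J\<close>, for a set \<open>J\<close>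
  of \<open>n - q + 1\<close> of them, lies in the ideal. This rewrites the monomial as a combination of monomials
  in which some of these factors have moved from \<open>q\<close> to smaller positions and no other factor has
  moved. Such rewriting stops because it decreases the sum of all positions.
\<close>

theorem monomial_mem:
  assumes "finite L" "p \<in> L \<rightarrow> {1..n}" "card L > n choose 2"
  shows "(\<Prod>l\<in>L. y (p l) l) \<in> I (card L)"
  using assms
proof (induction "\<Sum>l\<in>L. p l" arbitrary: p rule: less_induct)
  case less
  obtain q J where q: "q \<in> {1..n}" and J: "J \<subseteq> {l\<in>L. p l = q}" "card J = Suc (n - q)"
    using ex_crowded_position less.prems by metis
  have finJ: "finite J" and JL: "J \<subseteq> L"
    using J less.prems finite_subset[of J L] by auto
  let ?r = "\<Prod>l\<in>L - J. y (p l) l"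
  let ?F = "(J \<rightarrow>\<^sub>E {1..q}) - {\<lambda>l\<in>J. q}"
  let ?p = "\<lambda>f l. if l \<in> J then f l else p l"
  have split: "(\<Prod>l\<in>L. y (?p f l) l) = ?r * (\<Prod>l\<in>J. y (f l) l)" for f
  proof -
    have "(\<Prod>l\<in>L. y (?p f l) l) = (\<Prod>l\<in>L - J. y (?p f l) l) * (\<Prod>l\<in>J. y (?p f l) l)"
      by (rule prod.subset_diff[OF JL less.prems(1)])
    also have "\<dots> = ?r * (\<Prod>l\<in>J. y (f l) l)"
      by (intro arg_cong2[of _ _ _ _ "(*)"] prod.cong) auto
    finally show ?thesis .
  qed
  \<comment> \<open>all terms but the leading one have a smaller sum of positions\<close>
  have lower: "(\<Prod>l\<in>L. y (?p f l) l) \<in> I (card L)" if f: "f \<in> ?F" for f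
  proof (rule less.hyps)
    have f_le: "f l \<le> p l" if "l \<in> J" for l
      using f J that by (auto simp: PiE_iff)
    have "\<exists>l\<in>J. f l \<noteq> q"
    proof (rule ccontr)
      assume "\<not> ?thesis"
      then have "f = (\<lambda>l\<in>J. q)"
        using f by (auto simp: PiE_iff extensional_def)
      then show False
        using f by simp
    qed
    then obtain l where "l \<in> J" "f l < p l"
      using f_le J by (metis (mono_tags, lifting) mem_Collect_eq order_le_neq_trans subsetD)
    then show "(\<Sum>l\<in>L. ?p f l) < (\<Sum>l\<in>L. p l)"
      using f_le JL less.prems(1) by (intro sum_strict_mono_ex1) (auto intro!: bexI[of _ l])
    show "?p f \<in> L \<rightarrow> {1..n}"
      using f q less.prems by (auto simp: PiE_iff Pi_iff)
  qed (use less.prems in auto)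
  have "polarized_h y {1..q} J \<in> I (card J)"
    using q J finJ by (intro polarized_h_initial_segment) auto
  then have "?r * polarized_h y {1..q} J \<in> I (card J + card (L - J))"
    using less.prems by (intro prod_mult) auto
  also have "card J + card (L - J) = card L"
    using card_Diff_subset[OF finJ JL] card_mono[OF less.prems(1) JL] by simp
  finally have mem: "?r * polarized_h y {1..q} J
      - (\<Sum>f\<in>?F. of_nat (fibre_weight {1..q} J f) * (\<Prod>l\<in>L. y (?p f l) l)) \<in> I (card L)"
    by (intro diff sum of_nat_mult lower)
  have expand: "polarized_h y {1..q} J = of_nat (fact (card J)) * (\<Prod>l\<in>J. y q l)
      + (\<Sum>f\<in>?F. of_nat (fibre_weight {1..q} J f) * (\<Prod>l\<in>J. y (f l) l))"
    using q finJ by (intro polarized_h_leading) auto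
  have leading: "?r * (\<Prod>l\<in>J. y q l) = (\<Prod>l\<in>L. y (p l) l)"
  proof -
    have "(\<Prod>l\<in>J. y q l) = (\<Prod>l\<in>J. y (p l) l)"
      using J by (intro prod.cong) auto
    then show ?thesis
      using prod.subset_diff[OF JL less.prems(1), of "\<lambda>l. y (p l) l"] by simp
  qed
  have "of_nat (fact (card J)) * (\<Prod>l\<in>L. y (p l) l) \<in> I (card L)"
    using mem unfolding split expand leading[symmetric]
    by (simp only: distrib_left sum_distrib_left mult.left_commute[of ?r] add_diff_cancel_right')
  moreover have "card J \<le> n"
    using J q by auto
  ultimately show ?case
    by (rule cancel_fact[rotated])
qed

end

section \<open>Homogeneous polynomials\<close>

lemma Const_0 [simp]: "Const 0 = 0"
  by (simp add: Const_def)

lemma Const_1 [simp]: "Const 1 = 1"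
  by (simp add: Const_def)

lemma Const_add: "Const (a + b) = Const a + Const b"
  by (simp add: Const_def single_add)

lemma Const_uminus: "Const (- a) = - Const a"
  by (simp add: Const_def single_uminus)

lemma Const_mult: "Const (a * b) = Const a * Const b"
  by (simp add: Const_def mult_single)

lemma Const_of_nat: "Const (of_nat k) = of_nat k"
  by (induction k) (simp_all add: Const_add)

lemma mon_degree_superset:
  assumes "finite S" "Poly_Mapping.keys t \<subseteq> S"
  shows "mon_degree t = (\<Sum>x\<in>S. Poly_Mapping.lookup t x)"
  unfolding mon_degree_def using assms by (intro sum.mono_neutral_left) (auto simp: in_keys_iff)

lemma mon_degree_add: "mon_degree (s + t) = mon_degree s + mon_degree t"
proof -
  let ?S = "Poly_Mapping.keys s \<union> Poly_Mapping.keys t"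
  have "mon_degree (s + t) = (\<Sum>x\<in>?S. Poly_Mapping.lookup (s + t) x)"
    by (rule mon_degree_superset) (use keys_add[of s t] in auto)
  then show ?thesis
    by (simp add: lookup_add sum.distrib mon_degree_superset[of ?S s] mon_degree_superset[of ?S t])
qed

definition forms :: "'x set \<Rightarrow> nat \<Rightarrow> ('x, 'k::field) mpoly set" where
  "forms X d = {f \<in> coord_ring X. homogeneous d f}"

lemma forms_iff:
  "f \<in> forms X d \<longleftrightarrow> (\<forall>t\<in>Poly_Mapping.keys f. Poly_Mapping.keys t \<subseteq> X \<and> mon_degree t = d)"
  by (auto simp: forms_def coord_ring_def homogeneous_def)

lemma forms_0: "0 \<in> forms X d"
  by (simp add: forms_iff)

lemma forms_Const: "Const c \<in> forms X 0"
  by (auto simp: forms_iff Const_def mon_degree_def)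

lemma forms_Var: "x \<in> X \<Longrightarrow> Var x \<in> forms X 1"
  by (auto simp: forms_iff Var_def mon_degree_def)

lemma forms_add: "f \<in> forms X d \<Longrightarrow> h \<in> forms X d \<Longrightarrow> f + h \<in> forms X d"
  using keys_add[of f h] by (auto simp: forms_iff)

lemma forms_sum: "(\<And>i. i \<in> A \<Longrightarrow> F i \<in> forms X d) \<Longrightarrow> sum F A \<in> forms X d"
  by (induction A rule: infinite_finite_induct) (auto intro: forms_0 forms_add)

lemma forms_mult:
  assumes "f \<in> forms X d" "h \<in> forms X e"
  shows "f * h \<in> forms X (d + e)"
  unfolding forms_iff
proof
  fix t assume "t \<in> Poly_Mapping.keys (f * h)"
  then obtain r s where "t = r + s" "r \<in> Poly_Mapping.keys f" "s \<in> Poly_Mapping.keys h"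
    using keys_mult[of f h] by auto
  then show "Poly_Mapping.keys t \<subseteq> X \<and> mon_degree t = d + e"
    using assms keys_add[of r s] by (fastforce simp: forms_iff mon_degree_add)
qed

lemma forms_1: "1 \<in> forms X 0"
  using forms_Const[of 1] by simp

lemma forms_power: "f \<in> forms X d \<Longrightarrow> f ^ k \<in> forms X (k * d)"
  by (induction k) (auto intro: forms_1 forms_mult)

lemma forms_prod: "(\<And>i. i \<in> A \<Longrightarrow> F i \<in> forms X (d i)) \<Longrightarrow> prod F A \<in> forms X (sum d A)"
  by (induction A rule: infinite_finite_induct) (auto intro: forms_1 forms_mult)

lemma forms_of_nat_mult: "f \<in> forms X d \<Longrightarrow> of_nat k * f \<in> forms X d"
  using forms_mult[OF forms_Const[of "of_nat k"], of f X d] by (simp add: Const_of_nat)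

lemma coord_ring_Const: "Const (c :: 'k::field) \<in> coord_ring X"
  using forms_Const[of c X] by (simp add: forms_def)

lemma coord_ring_add: "f \<in> coord_ring X \<Longrightarrow> h \<in> coord_ring X \<Longrightarrow> f + h \<in> coord_ring X"
  using keys_add[of f h] by (auto simp: coord_ring_def)

lemma coord_ring_mult:
  assumes "f \<in> coord_ring X" "h \<in> coord_ring X"
  shows "f * h \<in> coord_ring X"
  unfolding coord_ring_def
proof (intro CollectI ballI)
  fix t assume "t \<in> Poly_Mapping.keys (f * h)"
  then obtain r s where "t = r + s" "r \<in> Poly_Mapping.keys f" "s \<in> Poly_Mapping.keys h"
    using keys_mult[of f h] by auto
  then show "Poly_Mapping.keys t \<subseteq> X"
    using assms keys_add[of r s] by (fastforce simp: coord_ring_def)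
qed

lemma sum_of_terms:
  "(\<Sum>t\<in>Poly_Mapping.keys f. Poly_Mapping.single t (Poly_Mapping.lookup f t)) = f"
  by (rule poly_mapping_eqI) (auto simp: lookup_sum lookup_single when_def sum.delta in_keys_iff)

text \<open>
  Writing a monomial as a product over \<open>{..<d}\<close> gives each of its \<open>d\<close> factors an index of its own, as
  the polarized polynomials require; repeated factors get different indices.
\<close>

lemma monomial_eq_prod_Var:
  "\<exists>v\<in>{..<mon_degree t} \<rightarrow> Poly_Mapping.keys t.
     Poly_Mapping.single t 1 = (\<Prod>l<mon_degree t. Var (v l) :: ('x, 'k::field) mpoly)"
proof (induction "mon_degree t" arbitrary: t)
  case 0
  then have "t = 0"
    by (auto simp: mon_degree_def in_keys_iff intro!: poly_mapping_eqI)
  then show ?case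
    by (simp add: mon_degree_def)
next
  case (Suc d)
  then obtain x where x: "x \<in> Poly_Mapping.keys t"
    by (force simp: mon_degree_def)
  define s where "s = t - Poly_Mapping.single x 1"
  have t: "t = s + Poly_Mapping.single x 1"
    using x by (intro poly_mapping_eqI)
      (auto simp: s_def lookup_add lookup_minus lookup_single when_def in_keys_iff)
  have deg: "mon_degree t = Suc (mon_degree s)"
    by (subst t) (simp add: mon_degree_add mon_degree_def[of "Poly_Mapping.single x (Suc 0)"])
  have keys: "Poly_Mapping.keys s \<subseteq> Poly_Mapping.keys t"
    by (auto simp: s_def lookup_minus in_keys_iff)
  obtain v where v: "v \<in> {..<mon_degree s} \<rightarrow> Poly_Mapping.keys s"
    "Poly_Mapping.single s 1 = (\<Prod>l<mon_degree s. Var (v l) :: ('x, 'k) mpoly)"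
    using Suc.hyps(1)[of s] Suc.hyps(2) deg by auto
  let ?v = "v(mon_degree s := x)"
  have "Poly_Mapping.single t 1 = Poly_Mapping.single s 1 * (Var x :: ('x, 'k) mpoly)"
    by (subst t) (simp add: Var_def mult_single)
  also have "\<dots> = (\<Prod>l<mon_degree t. Var (?v l))"
    unfolding v(2) deg by (simp add: lessThan_Suc mult.commute)
  finally have "Poly_Mapping.single t 1 = (\<Prod>l<mon_degree t. Var (?v l) :: ('x, 'k) mpoly)" .
  moreover have "?v \<in> {..<mon_degree t} \<rightarrow> Poly_Mapping.keys t"
    using v(1) keys x unfolding deg by (auto simp: Pi_iff less_Suc_eq)
  ultimately show ?case
    by (rule bexI)
qed

lemma single_eq_Const_mult:
  "Poly_Mapping.single t (c :: 'k::field) = Const c * Poly_Mapping.single t 1"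
  by (simp add: Const_def mult_single)

text \<open>
  For homomorphisms, and properties preserved by them, only constants and variables have to be checked.
\<close>

lemma coord_ring_induct [consumes 1, case_names Const Var add mult]:
  fixes f :: "('x, 'k::field) mpoly"
  assumes f: "f \<in> coord_ring X"
    and Const: "\<And>c. P (Const c)" and Var: "\<And>x. x \<in> X \<Longrightarrow> P (Var x)"
    and add: "\<And>f h. P f \<Longrightarrow> P h \<Longrightarrow> P (f + h)" and mult: "\<And>f h. P f \<Longrightarrow> P h \<Longrightarrow> P (f * h)"
  shows "P f"
proof -
  have sum: "P (sum F A)" if "\<And>i. i \<in> A \<Longrightarrow> P (F i)" for F and A :: "('x \<Rightarrow>\<^sub>0 nat) set"
    using that Const[of 0] by (induction A rule: infinite_finite_induct) (auto intro: add)
  have prod: "P (prod F A)" if "\<And>i. i \<in> A \<Longrightarrow> P (F i)" for F and A :: "nat set"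
    using that Const[of 1] by (induction A rule: infinite_finite_induct) (auto intro: mult)
  have "P (Poly_Mapping.single t (Poly_Mapping.lookup f t))" if t: "t \<in> Poly_Mapping.keys f" for t
  proof -
    obtain v where v: "v \<in> {..<mon_degree t} \<rightarrow> Poly_Mapping.keys t"
      "Poly_Mapping.single t 1 = (\<Prod>l<mon_degree t. Var (v l) :: ('x, 'k) mpoly)"
      using monomial_eq_prod_Var[of t, where 'k = 'k] by (elim bexE)
    have "Poly_Mapping.keys t \<subseteq> X"
      using f t by (simp add: coord_ring_def)
    then have "v l \<in> X" if "l \<in> {..<mon_degree t}" for l
      using funcset_mem[OF v(1) that] by blast
    then have "P (Const (Poly_Mapping.lookup f t) * (\<Prod>l<mon_degree t. Var (v l)))"
      by (intro mult Const prod Var)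
    then show ?thesis
      by (simp only: single_eq_Const_mult[of t "Poly_Mapping.lookup f t"] v(2))
  qed
  then show ?thesis
    by (subst sum_of_terms[symmetric]) (rule sum)
qed

section \<open>Linear substitutions as algebra homomorphisms\<close>

definition subst_monomial :: "('x \<Rightarrow> 'a::comm_monoid_mult) \<Rightarrow> ('x \<Rightarrow>\<^sub>0 nat) \<Rightarrow> 'a" where
  "subst_monomial \<phi> t = (\<Prod>x\<in>Poly_Mapping.keys t. \<phi> x ^ Poly_Mapping.lookup t x)"

lemma subst_monomial_superset:
  "finite S \<Longrightarrow> Poly_Mapping.keys t \<subseteq> S \<Longrightarrow>
     subst_monomial \<phi> t = (\<Prod>x\<in>S. \<phi> x ^ Poly_Mapping.lookup t x)"
  unfolding subst_monomial_def by (rule prod.mono_neutral_left) (auto simp: in_keys_iff)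

lemma subst_monomial_add: "subst_monomial \<phi> (s + t) = subst_monomial \<phi> s * subst_monomial \<phi> t"
proof -
  let ?S = "Poly_Mapping.keys s \<union> Poly_Mapping.keys t"
  have "subst_monomial \<phi> (s + t) = (\<Prod>x\<in>?S. \<phi> x ^ Poly_Mapping.lookup (s + t) x)"
    by (rule subst_monomial_superset) (use keys_add[of s t] in auto)
  then show ?thesis
    by (simp add: lookup_add power_add prod.distrib
        subst_monomial_superset[of ?S s] subst_monomial_superset[of ?S t])
qed

lemma pullback_superset:
  assumes "finite S" "Poly_Mapping.keys f \<subseteq> S"
  shows "pullback X A f
    = (\<Sum>t\<in>S. Const (Poly_Mapping.lookup f t) * subst_monomial (linear_form X A) t)"
  unfolding pullback_def subst_monomial_def
  using assms by (intro sum.mono_neutral_left) (auto simp: in_keys_iff)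

lemma pullback_single:
  "pullback X A (Poly_Mapping.single t c) = Const c * subst_monomial (linear_form X A) t"
  by (subst pullback_superset[of "{t}"]) auto

lemma pullback_Const: "pullback X A (Const c) = Const c"
  by (simp add: Const_def[of c, THEN arg_cong[of _ _ "pullback X A"]] pullback_single subst_monomial_def)

lemma pullback_add: "pullback X A (f + h) = pullback X A f + pullback X A h"
proof -
  let ?S = "Poly_Mapping.keys f \<union> Poly_Mapping.keys h"
  have "pullback X A (f + h)
      = (\<Sum>t\<in>?S. Const (Poly_Mapping.lookup (f + h) t) * subst_monomial (linear_form X A) t)"
    by (rule pullback_superset) (use keys_add[of f h] in auto)
  then show ?thesis
    by (simp add: lookup_add Const_add distrib_right sum.distrib
        pullback_superset[of ?S f] pullback_superset[of ?S h])
qed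

lemma pullback_mult: "pullback X A (f * h) = pullback X A f * pullback X A h"
proof (induction f rule: mpoly_induct)
  case (single t c)
  show ?case
  proof (induction h rule: mpoly_induct)
    case (single s d)
    show ?case
      by (simp add: mult_single pullback_single subst_monomial_add Const_mult ac_simps)
  qed (simp add: distrib_left pullback_add)
qed (simp add: distrib_right pullback_add)

lemma pullback_0: "pullback X A 0 = 0"
  using pullback_Const[of X A 0] by simp

lemma pullback_1: "pullback X A 1 = 1"
  using pullback_Const[of X A 1] by simp

lemma pullback_of_nat: "pullback X A (of_nat k) = of_nat k"
  using pullback_Const[of X A "of_nat k"] by (simp add: Const_of_nat)

lemma pullback_sum: "pullback X A (sum F I) = (\<Sum>i\<in>I. pullback X A (F i))"
  by (induction I rule: infinite_finite_induct) (simp_all add: pullback_0 pullback_add)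

lemma pullback_prod: "pullback X A (prod F I) = (\<Prod>i\<in>I. pullback X A (F i))"
  by (induction I rule: infinite_finite_induct) (simp_all add: pullback_1 pullback_mult)

lemma linear_form_forms: "linear_form X A x \<in> forms X 1"
  unfolding linear_form_def using forms_mult[OF forms_Const forms_Var]
  by (intro forms_sum) fastforce

lemma pullback_forms: "f \<in> forms X d \<Longrightarrow> pullback X A f \<in> forms X d"
  unfolding pullback_def
proof (intro forms_sum)
  fix t assume f: "f \<in> forms X d" and t: "t \<in> Poly_Mapping.keys f"
  have "(\<Prod>x\<in>Poly_Mapping.keys t. linear_form X A x ^ Poly_Mapping.lookup t x)
      \<in> forms X (\<Sum>x\<in>Poly_Mapping.keys t. Poly_Mapping.lookup t x * 1)"
    by (intro forms_prod forms_power linear_form_forms)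
  moreover have "(\<Sum>x\<in>Poly_Mapping.keys t. Poly_Mapping.lookup t x * 1) = d"
    using f t by (simp add: forms_iff mon_degree_def)
  ultimately have "(\<Prod>x\<in>Poly_Mapping.keys t. linear_form X A x ^ Poly_Mapping.lookup t x) \<in> forms X d"
    by simp
  from forms_mult[OF forms_Const this]
  show "Const (Poly_Mapping.lookup f t) *
      (\<Prod>x\<in>Poly_Mapping.keys t. linear_form X A x ^ Poly_Mapping.lookup t x) \<in> forms X d"
    by simp
qed

section \<open>The action of permutations of the positions\<close>

text \<open>
  The action of the full symmetric group. The action of a subgroup \<open>G\<close> refers to inverses in \<open>G\<close>, which
  are those in the symmetric group, so that one function serves for all \<open>G\<close>.
\<close>

definition perm_act :: "nat \<Rightarrow> nat \<Rightarrow> (nat \<Rightarrow> nat) \<Rightarrow>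
    (nat \<times> nat, 'k::field) mpoly \<Rightarrow> (nat \<times> nat, 'k) mpoly" where
  "perm_act n m g = poly_action (sym_group n) ({1..n} \<times> {1..m}) (diag_rep perm_rep) g"

lemma poly_action_subgroup:
  assumes "subgroup G (sym_group n)" "g \<in> G"
  shows "poly_action ((sym_group n)\<lparr>carrier := G\<rparr>) ({1..n} \<times> {1..m}) (diag_rep perm_rep) g f
    = perm_act n m g f"
  using group.m_inv_consistent[OF sym_group_is_group assms]
  by (simp add: perm_act_def poly_action_def)

lemma perm_act_Var:
  assumes "g permutes {1..n}" "i \<in> {1..n}" "j \<in> {1..m}"
  shows "perm_act n m g (Var (i, j)) = Var (g i, j)"
proof -
  have G: "subgroup (carrier (sym_group n)) (sym_group n)"
    by (rule group.subgroup_self[OF sym_group_is_group])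
  have g: "g \<in> carrier (sym_group n)"
    using assms by (simp add: sym_group_carrier)
  show ?thesis
    using poly_action_perm_Var[OF G g assms(2,3)] unfolding poly_action_subgroup[OF G g] .
qed

lemma perm_act_hom:
  "perm_act n m g (Const c) = Const c"
  "perm_act n m g (of_nat k) = of_nat k"
  "perm_act n m g (f + h) = perm_act n m g f + perm_act n m g h"
  "perm_act n m g (f * h) = perm_act n m g f * perm_act n m g h"
  "perm_act n m g (sum F S) = (\<Sum>s\<in>S. perm_act n m g (F s))"
  "perm_act n m g (prod F' S') = (\<Prod>s\<in>S'. perm_act n m g (F' s))"
  by (simp_all add: perm_act_def poly_action_def pullback_Const pullback_of_nat pullback_add
      pullback_mult pullback_sum pullback_prod)

lemma perm_act_forms: "f \<in> forms ({1..n} \<times> {1..m}) d \<Longrightarrow> perm_act n m g f \<in> forms ({1..n} \<times> {1..m}) d"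
  by (simp add: perm_act_def poly_action_def pullback_forms)

lemma perm_act_comp:
  assumes g: "g permutes {1..n}" and h: "h permutes {1..n}"
    and f: "f \<in> coord_ring ({1..n} \<times> {1..m})"
  shows "perm_act n m g (perm_act n m h f) = perm_act n m (g \<circ> h) f"
  using f
proof (induction f rule: coord_ring_induct)
  case (Var x)
  then obtain i j where x: "x = (i, j)" "i \<in> {1..n}" "j \<in> {1..m}"
    by auto
  have "h i \<in> {1..n}"
    using x permutes_in_image[OF h] by blast
  then show ?case
    unfolding x(1) perm_act_Var[OF h x(2,3)] perm_act_Var[OF permutes_compose[OF h g] x(2,3)]
    using x(3) by (simp only: perm_act_Var[OF g] o_apply)
qed (simp_all add: perm_act_hom)

lemma perm_act_polarized_h:
  assumes "g permutes {1..n}" "\<And>l. u l \<in> {1..m}"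
  shows "perm_act n m g (polarized_h (\<lambda>i l. Var (i, u l)) {1..n} J)
    = (polarized_h (\<lambda>i l. Var (i, u l)) {1..n} J :: (nat \<times> nat, 'k::field) mpoly)"
proof -
  have "perm_act n m g (polarized_h (\<lambda>i l. Var (i, u l)) {1..n} J)
      = (polarized_h (\<lambda>i l. Var (g i, u l)) {1..n} J :: (nat \<times> nat, 'k) mpoly)"
    unfolding polarized_h_def perm_act_hom
    by (intro sum.cong prod.cong refl arg_cong2[of _ _ _ _ "(*)"] perm_act_Var assms) (auto simp: PiE_iff)
  also have "\<dots> = polarized_h (\<lambda>i l. Var (i, u l)) {1..n} J"
    using polarized_h_permute[OF assms(1), of "\<lambda>i l. Var (i, u l)" J] by simp
  finally show ?thesis .
qed

lemma polarized_h_forms: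
  assumes "P \<subseteq> {1..n}" "\<And>l. u l \<in> {1..m}"
  shows "polarized_h (\<lambda>i l. Var (i, u l)) P J \<in> forms ({1..n} \<times> {1..m}) (card J)"
  unfolding polarized_h_def
proof (intro forms_sum forms_of_nat_mult)
  fix f assume f: "f \<in> J \<rightarrow>\<^sub>E P"
  have "(\<Prod>l\<in>J. Var (f l, u l)) \<in> forms ({1..n} \<times> {1..m}) (\<Sum>l\<in>J. 1)"
    using f assms by (intro forms_prod forms_Var) (auto simp: PiE_iff)
  then show "(\<Prod>l\<in>J. Var (f l, u l)) \<in> forms ({1..n} \<times> {1..m}) (card J)"
    by simp
qed

section \<open>The ideal generated by symmetric invariants\<close>

text \<open>
  The degree \<open>d\<close> part of the ideal generated by the invariants of the full symmetric group that have
  degree between \<open>1\<close> and \<open>n\<close>. The degrees of both factors are recorded because the induction over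
  degrees needs the cofactor \<open>a\<close> to be homogeneous of degree less than \<open>d\<close>.
\<close>

inductive_set symmetric_ideal :: "nat \<Rightarrow> nat \<Rightarrow> nat \<Rightarrow> (nat \<times> nat, 'k::field) mpoly set"
  for n m d where
  zero: "0 \<in> symmetric_ideal n m d"
| add: "f \<in> symmetric_ideal n m d \<Longrightarrow> h \<in> symmetric_ideal n m d \<Longrightarrow> f + h \<in> symmetric_ideal n m d"
| gen: "a \<in> forms ({1..n} \<times> {1..m}) e \<Longrightarrow> s \<in> forms ({1..n} \<times> {1..m}) k \<Longrightarrow>
    (\<And>g. g permutes {1..n} \<Longrightarrow> perm_act n m g s = s) \<Longrightarrow>
    1 \<le> k \<Longrightarrow> k \<le> n \<Longrightarrow> e + k = d \<Longrightarrow> a * s \<in> symmetric_ideal n m d"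

lemma symmetric_ideal_mult:
  assumes "f \<in> symmetric_ideal n m d" "b \<in> forms ({1..n} \<times> {1..m}) e"
  shows "b * f \<in> symmetric_ideal n m (e + d)"
  using assms(1)
proof induction
  case (gen a e' s k)
  have "b * a * s \<in> symmetric_ideal n m (e + d)"
    using gen by (intro symmetric_ideal.gen[of _ _ _ "e + e'" _ k] forms_mult assms) auto
  then show ?case
    by (simp add: mult.assoc)
qed (auto simp: distrib_left intro: symmetric_ideal.intros)

lemma symmetric_ideal_sum:
  "(\<And>i. i \<in> A \<Longrightarrow> F i \<in> symmetric_ideal n m d) \<Longrightarrow> sum F A \<in> symmetric_ideal n m d"
  by (induction A rule: infinite_finite_induct) (auto intro: symmetric_ideal.intros)

lemma symmetric_ideal_Const_mult:
  "f \<in> symmetric_ideal n m d \<Longrightarrow> Const c * f \<in> symmetric_ideal n m d"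
  using symmetric_ideal_mult[OF _ forms_Const] by fastforce

text \<open>
  A prime larger than \<open>n\<close> does not divide \<open>n!\<close>.
\<close>

lemma fact_of_nat_neq_0:
  assumes "CHAR('k::field) = 0 \<or> CHAR('k) > n" "k \<le> n"
  shows "(of_nat (fact k) :: 'k) \<noteq> 0"
proof
  assume "(of_nat (fact k) :: 'k) = 0"
  then have dvd: "CHAR('k) dvd fact k"
    by (simp only: of_nat_eq_0_iff_char_dvd)
  then have pos: "CHAR('k) > 0"
    by (metis dvd_0_left_iff fact_nonzero gr0I)
  then have "prime CHAR('k)"
    by (rule prime_CHAR_semidom)
  then show False
    using dvd assms pos by (simp add: prime_dvd_fact_iff)
qed

lemma graded_ideal_with_symmetric_ideal:
  assumes "CHAR('k::field) = 0 \<or> CHAR('k) > n" "\<And>l. u l \<in> {1..m}"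
  shows "graded_ideal_with_symmetric (\<lambda>i l. Var (i, u l)) n
    (symmetric_ideal n m :: nat \<Rightarrow> (nat \<times> nat, 'k) mpoly set)"
proof
  fix a :: "(nat \<times> nat, 'k) mpoly" and d
  assume "a \<in> symmetric_ideal n m d"
  then show "- a \<in> symmetric_ideal n m d"
    using symmetric_ideal_Const_mult[of a n m d "- 1"] by (simp add: Const_uminus)
next
  fix a :: "(nat \<times> nat, 'k) mpoly" and d i l
  assume "i \<in> {1..n}" "a \<in> symmetric_ideal n m d"
  then show "Var (i, u l) * a \<in> symmetric_ideal n m (Suc d)"
    using symmetric_ideal_mult[OF _ forms_Var, of a n m d "(i, u l)"] assms(2) by simp
next
  fix a :: "(nat \<times> nat, 'k) mpoly" and d k
  assume k: "k \<le> n" and a: "of_nat (fact k) * a \<in> symmetric_ideal n m d"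
  have "Const (inverse (of_nat (fact k))) * (of_nat (fact k) * a) \<in> symmetric_ideal n m d"
    by (rule symmetric_ideal_Const_mult[OF a])
  also have "Const (inverse (of_nat (fact k))) * (of_nat (fact k) * a)
      = Const (inverse (of_nat (fact k)) * of_nat (fact k)) * a"
    by (simp only: Const_mult Const_of_nat mult.assoc)
  also have "\<dots> = a"
    using fact_of_nat_neq_0[OF assms(1) k] by (simp del: of_nat_fact)
  finally show "a \<in> symmetric_ideal n m d" .
next
  fix J :: "'a set"
  assume J: "finite J" "J \<noteq> {}" "card J \<le> n"
  have "1 * polarized_h (\<lambda>i l. Var (i, u l)) {1..n} J
      \<in> (symmetric_ideal n m (card J) :: (nat \<times> nat, 'k) mpoly set)"
    using J by (intro symmetric_ideal.gen[OF forms_1 polarized_h_forms] perm_act_polarized_h assms)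
      (auto simp: Suc_le_eq card_gt_0_iff)
  then show "polarized_h (\<lambda>i l. Var (i, u l)) {1..n} J
      \<in> (symmetric_ideal n m (card J) :: (nat \<times> nat, 'k) mpoly set)"
    by simp
qed (auto intro: symmetric_ideal.intros)

text \<open>
  In other words, the coinvariants of \<open>m\<close> copies of the permutation representation of the symmetric
  group vanish in degrees above \<open>n choose 2\<close>. This is the monomial reduction for the variables
  \<open>Var (i, u l)\<close>: the second index of the \<open>l\<close>-th factor stays fixed while its position \<open>i\<close> varies.
\<close>

theorem forms_subset_symmetric_ideal:
  assumes char: "CHAR('k::field) = 0 \<or> CHAR('k) > n" and "m \<ge> 1"
    and f: "(f :: (nat \<times> nat, 'k) mpoly) \<in> forms ({1..n} \<times> {1..m}) d" and d: "d > n choose 2"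
  shows "f \<in> symmetric_ideal n m d"
proof -
  have "Poly_Mapping.single t (Poly_Mapping.lookup f t) \<in> symmetric_ideal n m d"
    if "t \<in> Poly_Mapping.keys f" for t
  proof -
    have t: "mon_degree t = d" "Poly_Mapping.keys t \<subseteq> {1..n} \<times> {1..m}"
      using f that by (auto simp: forms_iff)
    obtain v where v: "v \<in> {..<d} \<rightarrow> Poly_Mapping.keys t"
      "Poly_Mapping.single t 1 = (\<Prod>l<d. Var (v l) :: (nat \<times> nat, 'k) mpoly)"
      using monomial_eq_prod_Var[of t, where 'k = 'k] unfolding t(1) by (elim bexE)
    \<comment> \<open>the value 1 outside \<open>{..<d}\<close> only serves to have \<open>u l \<in> {1..m}\<close> for all \<open>l\<close>\<close>
    define u where "u l = (if l < d then snd (v l) else 1)" for l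
    have v_range: "v l \<in> {1..n} \<times> {1..m}" if "l < d" for l
      using v(1) t(2) that by auto
    then have u: "u l \<in> {1..m}" for l
      using \<open>m \<ge> 1\<close> by (simp add: u_def mem_Times_iff)
    interpret graded_ideal_with_symmetric "\<lambda>i l. Var (i, u l)" n
      "symmetric_ideal n m :: nat \<Rightarrow> (nat \<times> nat, 'k) mpoly set"
      by (rule graded_ideal_with_symmetric_ideal[OF char u])
    have "(\<Prod>l\<in>{..<d}. Var (fst (v l), u l)) \<in> (symmetric_ideal n m (card {..<d}) :: (nat \<times> nat, 'k) mpoly set)"
      using v_range d by (intro monomial_mem) (auto simp: mem_Times_iff)
    also have "(\<Prod>l\<in>{..<d}. Var (fst (v l), u l)) = (Poly_Mapping.single t 1 :: (nat \<times> nat, 'k) mpoly)"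
      unfolding v(2) by (intro prod.cong) (auto simp: u_def)
    finally show ?thesis
      unfolding single_eq_Const_mult[of t "Poly_Mapping.lookup f t"] by (simp add: symmetric_ideal_Const_mult)
  qed
  then have "(\<Sum>t\<in>Poly_Mapping.keys f. Poly_Mapping.single t (Poly_Mapping.lookup f t))
      \<in> symmetric_ideal n m d"
    by (rule symmetric_ideal_sum)
  then show ?thesis
    by (simp add: sum_of_terms)
qed

section \<open>Averaging over the group\<close>

lemma invariants_iff:
  assumes "subgroup G (sym_group n)"
  shows "f \<in> invariants ((sym_group n)\<lparr>carrier := G\<rparr>) ({1..n} \<times> {1..m}) (diag_rep perm_rep)
    \<longleftrightarrow> f \<in> coord_ring ({1..n} \<times> {1..m}) \<and> (\<forall>g\<in>G. perm_act n m g f = f)"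
  by (simp add: invariants_def poly_action_subgroup[OF assms] del: One_nat_def)

text \<open>
  The averaging operator without the division by the group order.
\<close>

definition transfer :: "(nat \<Rightarrow> nat) set \<Rightarrow> nat \<Rightarrow> nat \<Rightarrow>
    (nat \<times> nat, 'k::field) mpoly \<Rightarrow> (nat \<times> nat, 'k) mpoly" where
  "transfer G n m f = (\<Sum>g\<in>G. perm_act n m g f)"

lemma transfer_sum: "transfer G n m (sum F A) = (\<Sum>i\<in>A. transfer G n m (F i))"
  unfolding transfer_def perm_act_hom by (rule sum.swap)

lemma transfer_0: "transfer G n m 0 = 0"
  using transfer_sum[of G n m id "{}"] by simp

lemma transfer_forms:
  "f \<in> forms ({1..n} \<times> {1..m}) d \<Longrightarrow> transfer G n m f \<in> forms ({1..n} \<times> {1..m}) d"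
  unfolding transfer_def by (intro forms_sum perm_act_forms)

context
  fixes G :: "(nat \<Rightarrow> nat) set" and n :: nat
  assumes G: "subgroup G (sym_group n)"
begin

lemma group_elem_permutes: "g \<in> G \<Longrightarrow> g permutes {1..n}"
  using subgroup.subset[OF G] by (auto simp: sym_group_carrier)

lemma group_finite: "finite G"
  by (rule finite_subset[OF _ finite_permutations[of "{1..n}"]])
    (auto simp del: One_nat_def intro: group_elem_permutes)

lemma card_group_dvd: "card G dvd fact n"
proof -
  have "card (rcosets\<^bsub>sym_group n\<^esub> G) * card G = Coset.order (sym_group n)"
    using group.lagrange[OF sym_group_is_group G] .
  moreover have "carrier (sym_group n) = {p. p permutes {1..n}}"
    by (auto simp: sym_group_carrier)
  then have "Coset.order (sym_group n) = fact n"
    by (simp add: Coset.order_def card_permutations)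
  ultimately show ?thesis
    by (metis dvd_triv_right)
qed

lemma perm_act_transfer:
  assumes "h \<in> G" "f \<in> coord_ring ({1..n} \<times> {1..m})"
  shows "perm_act n m h (transfer G n m f) = transfer G n m f"
proof -
  have "inj_on ((\<circ>) h) G"
    using permutes_inj[OF group_elem_permutes[OF assms(1)]] by (auto intro!: inj_onI dest: fun.inj_map injD)
  moreover have "(\<circ>) h ` G \<subseteq> G"
    using subgroup.m_closed[OF G assms(1)] by (auto simp: sym_group_mult)
  ultimately have bij: "bij_betw ((\<circ>) h) G G"
    using endo_inj_surj[OF group_finite] by (auto simp: bij_betw_def)
  have "perm_act n m h (transfer G n m f) = (\<Sum>g\<in>G. perm_act n m (h \<circ> g) f)"
    unfolding transfer_def perm_act_hom
    by (intro sum.cong refl perm_act_comp group_elem_permutes assms)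
  also have "\<dots> = transfer G n m f"
    unfolding transfer_def by (rule sum.reindex_bij_betw[OF bij])
  finally show ?thesis .
qed

lemma transfer_mult_symmetric:
  assumes "\<And>g. g permutes {1..n} \<Longrightarrow> perm_act n m g s = s"
  shows "transfer G n m (a * s) = transfer G n m a * s"
  unfolding transfer_def perm_act_hom sum_distrib_right
  by (intro sum.cong refl) (simp add: assms group_elem_permutes del: One_nat_def)

lemma transfer_invariant:
  "(\<And>g. g \<in> G \<Longrightarrow> perm_act n m g f = f) \<Longrightarrow> transfer G n m f = of_nat (card G) * f"
  by (simp add: transfer_def)

text \<open>
  Above degree \<open>b\<close>, a form is a combination \<open>\<Sum>\<^sub>i a\<^sub>i s\<^sub>i\<close> with \<open>s\<^sub>i\<close> invariant under all permutations,
  of degree between \<open>1\<close> and \<open>n\<close>. The transfer is linear over such \<open>s\<^sub>i\<close>, so that it maps the form to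
  \<open>\<Sum>\<^sub>i transfer(a\<^sub>i) s\<^sub>i\<close>, and the \<open>a\<^sub>i\<close> have smaller degree.
\<close>

lemma transfer_mem_generated_algebra:
  fixes a :: "(nat \<times> nat, 'k::field) mpoly"
  assumes char: "CHAR('k) = 0 \<or> CHAR('k) > n" and m: "m \<ge> 1"
    and b: "n \<le> b" "n choose 2 \<le> b"
    and a: "a \<in> forms ({1..n} \<times> {1..m}) d"
  shows "transfer G n m a \<in> generated_algebra
    {f \<in> invariants ((sym_group n)\<lparr>carrier := G\<rparr>) ({1..n} \<times> {1..m}) (diag_rep perm_rep).
      \<exists>e\<le>b. homogeneous e f}"
    (is "_ \<in> ?A")
  using a
proof (induction d arbitrary: a rule: less_induct)
  case (less d)
  show ?case
  proof (cases "d \<le> b")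
    case True
    have "a \<in> coord_ring ({1..n} \<times> {1..m})"
      "transfer G n m a \<in> coord_ring ({1..n} \<times> {1..m})" "homogeneous d (transfer G n m a)"
      using less.prems transfer_forms[OF less.prems, of G] by (auto simp: forms_def)
    then show ?thesis
      using True by (intro generated_algebra.gen) (auto simp: invariants_iff[OF G] perm_act_transfer simp del: One_nat_def)
  next
    case False
    have "a \<in> symmetric_ideal n m d"
      using False b less.prems by (intro forms_subset_symmetric_ideal[OF char m]) auto
    then show ?thesis
    proof induction
      case zero
      show ?case
        using generated_algebra.const[of 0] by (simp only: transfer_0 Const_0)
    next
      case (add f h)
      have "transfer G n m (f + h) = transfer G n m f + transfer G n m h"
        by (simp add: transfer_def perm_act_hom sum.distrib)
      then show ?case
        using add.IH by (simp add: generated_algebra.add)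
    next
      case (gen a' e s k)
      have "transfer G n m a' \<in> ?A"
        using gen by (intro less.IH) auto
      moreover have "s \<in> ?A"
        using gen b by (intro generated_algebra.gen)
          (auto simp: invariants_iff[OF G] forms_def group_elem_permutes simp del: One_nat_def intro!: exI[of _ k])
      ultimately show ?case
        using gen.hyps by (simp add: transfer_mult_symmetric generated_algebra.mult del: One_nat_def)
    qed
  qed
qed

text \<open>
  An invariant \<open>f\<close> is its own transfer divided by \<open>card G\<close>, and the transfer of \<open>f\<close> is the sum of the
  transfers of its terms. The number \<open>card G\<close> is nonzero in the field because it divides \<open>n!\<close>,
  which is nonzero there.
\<close>

lemma invariants_generated:
  assumes char: "CHAR('k::field) = 0 \<or> CHAR('k) > n" and m: "m \<ge> 1"
    and b: "n \<le> b" "n choose 2 \<le> b"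
  shows "invariants ((sym_group n)\<lparr>carrier := G\<rparr>) ({1..n} \<times> {1..m}) (diag_rep perm_rep)
    = generated_algebra
      {f \<in> invariants ((sym_group n)\<lparr>carrier := G\<rparr>) ({1..n} \<times> {1..m})
        (diag_rep (perm_rep :: (nat \<Rightarrow> nat) \<Rightarrow> (nat \<Rightarrow> 'k) \<Rightarrow> nat \<Rightarrow> 'k)).
       \<exists>e\<le>b. homogeneous e f}"
    (is "?I = ?A")
proof (intro equalityI subsetI)
  fix f assume f: "f \<in> ?I"
  then have X: "f \<in> coord_ring ({1..n} \<times> {1..m})" and inv: "transfer G n m f = of_nat (card G) * f"
    by (auto simp: invariants_iff[OF G] transfer_invariant simp del: One_nat_def)
  have sum: "sum F S \<in> ?A" if "\<And>i. i \<in> S \<Longrightarrow> F i \<in> ?A" for F and S :: "(nat \<times> nat \<Rightarrow>\<^sub>0 nat) set"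
    using that generated_algebra.const[of 0]
    by (induction S rule: infinite_finite_induct) (auto intro: generated_algebra.add)
  have "transfer G n m (Poly_Mapping.single t (Poly_Mapping.lookup f t)) \<in> ?A"
    if "t \<in> Poly_Mapping.keys f" for t
    using that X by (intro transfer_mem_generated_algebra[OF char m b, of _ "mon_degree t"])
      (auto simp: forms_iff coord_ring_def)
  then have "(\<Sum>t\<in>Poly_Mapping.keys f.
      transfer G n m (Poly_Mapping.single t (Poly_Mapping.lookup f t))) \<in> ?A"
    by (rule sum)
  then have "of_nat (card G) * f \<in> ?A"
    unfolding transfer_sum[symmetric] sum_of_terms inv .
  then have "Const (inverse (of_nat (card G))) * (of_nat (card G) * f) \<in> ?A"
    by (rule generated_algebra.mult[OF generated_algebra.const])
  moreover have "(of_nat (card G) :: 'k) \<noteq> 0"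
    using fact_of_nat_neq_0[OF char order_refl] card_group_dvd
    by (metis dvdE mult_zero_left of_nat_mult)
  then have "Const (inverse (of_nat (card G))) * (of_nat (card G) * f) = f"
    by (simp flip: Const_of_nat mult.assoc Const_mult)
  ultimately show "f \<in> ?A"
    by simp
next
  fix f assume "f \<in> ?A"
  then show "f \<in> ?I"
    by induction (auto simp: invariants_iff[OF G] perm_act_hom coord_ring_Const coord_ring_add coord_ring_mult
        simp del: One_nat_def)
qed

end

theorem theorem5:
  fixes n m :: nat
    and G :: "(nat \<Rightarrow> nat) set"
  assumes "n \<ge> 1" and "m \<ge> 1"
    and "CHAR('k::field) = 0 \<or> CHAR('k) > n"
    and "subgroup G (sym_group n)"
  shows "beta ((sym_group n)\<lparr>carrier := G\<rparr>) ({1..n} \<times> {1..m})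
             (diag_rep (perm_rep :: (nat \<Rightarrow> nat) \<Rightarrow> (nat \<Rightarrow> 'k) \<Rightarrow> nat \<Rightarrow> 'k))
           \<le> enat ((n choose 2) + 1)"
proof -
  have "n \<le> (n choose 2) + 1"
  proof (cases "n \<le> 1")
    case False
    then obtain k where "n = Suc (Suc k)"
      by (metis One_nat_def Suc_n_not_le_n not0_implies_Suc nat_le_linear)
    then show ?thesis
      by (simp add: numeral_2_eq_2)
  qed simp
  then show ?thesis
    unfolding beta_def using invariants_generated[OF assms(4,3,2), of "(n choose 2) + 1"]
    by (intro Inf_lower) auto
qed

end
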